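(* Let $C\subseteq\mathbb{R}^n$ be a proper convex cone, let $k$ and $m$ be positive integers, and let $K_1,\ldots,K_m$ be closed convex cones (each in some finite-dimensional real vector space $\mathbb{R}^{d_i}$) with $\ell(K_i)\leq k+1$ for each $i=1,2,\ldots,m$. Suppose that for each $N\in\mathbb{N}$ there exists a subset $V_N\subseteq \mathrm{ext}(C)$ such that $C$ is $k$-neighborly with respect to $V_N$ and $|V_N|\geq N$. Then $C$ does not have a $K_1\times\cdots\times K_m$-lift.
   Context: Fix an inner product $\langle\cdot,\cdot\rangle$ on $\mathbb{R}^n$ with associated norm $\|\cdot\|$. For $C\subseteq\mathbb{R}^n$, the dual cone is $C^*=\{f\in\mathbb{R}^n : \langle f,x\rangle\geq 0 \text{ for all } x\in C\}$. A convex cone $C\subseteq\mathbb{R}^n$ is proper if it is closed, pointed ($C\cap(-C)=\{0\}$) and full-dimensional ($\mathrm{span}(C)=\mathbb{R}^n$). Lift: if $C\subseteq\mathbb{R}^n$ and $K\subseteq\mathbb{R}^d$ are closed convex cones, $C$ has a $K$-lift if $C=\pi(K\cap L)$ for some linear map $\pi:\mathbb{R}^d\to\mathbb{R}^n$ and some linear subspace $L\subseteq\mathbb{R}^d$. Faces and chains: a face of a closed convex cone $K$ is a convex subset $F\subseteq K$ such that whenever $x,y\in K$ and $\alpha x+(1-\alpha)y\in F$ for some $\alpha\in(0,1)$, then $x,y\in F$. A chain of faces of length $\ell$ is a sequence $F_1\subsetneq F_2\subsetneq\cdots\subsetneq F_\ell$ of faces. $\ell(K)$ denotes the maximum length of a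 chain of nonempty faces of $K$ (it is finite, at most $\dim(\mathrm{span}(K))+1$). Extreme rays: $\mathrm{ext}(C)$ is the set of normalized extreme rays of $C$, i.e. the unit vectors $v$ (with $\|v\|=1$) such that the ray $\mathbb{R}_+v$ is an extreme ray (a face that is a half-line) of $C$. Neighborliness: if $C$ is a proper convex cone and $V\subseteq\mathrm{ext}(C)$, then $C$ is $k$-neighborly with respect to $V$ if for every $k$-element subset $W\subset V$ there is $f_W\in C^*$ such that $\langle f_W,v\rangle=0$ for $v\in W$ and $\langle f_W,v\rangle>0$ for $v\in V\setminus W$. *)

theory Defs
  imports
    "HOL-Analysis.Analysis"
    "HOL-Library.Function_Algebras"
    "HOL-Library.Extended_Nat"
begin

instantiation "fun" :: (type, real_vector) real_vector
begin

definition scaleR_fun :: "real \<Rightarrow> ('a \<Rightarrow> 'b) \<Rightarrow> 'a \<Rightarrow> 'b"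
  where "c *\<^sub>R f = (\<lambda>x. c *\<^sub>R f x)"

instance
  by standard (simp_all add: scaleR_fun_def fun_eq_iff scaleR_add_right scaleR_add_left)

end

lemma scaleR_fun_apply [simp]: "(c *\<^sub>R f) x = c *\<^sub>R f x"
  by (simp add: scaleR_fun_def)

(* R^d, for a number d that may vary inside a formula: the real sequences supported on {..<d}.
   On this finite-dimensional closed subspace the product topology of nat => real is the
   Euclidean topology, so "closed" has its usual meaning for its subsets. *)
definition coord_space :: "nat \<Rightarrow> (nat \<Rightarrow> real) set"
  where "coord_space d = {x. \<forall>j\<ge>d. x j = 0}"

(* K 1 \<times> ... \<times> K m. The entries at indices outside {1..m} are set to 0, so that
   an element is determined by its m components. *)
definition product_set :: "nat \<Rightarrow> (nat \<Rightarrow> 'b::zero set) \<Rightarrow> (nat \<Rightarrow> 'b) set"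
  where "product_set m K = {x. (\<forall>i\<in>{1..m}. x i \<in> K i) \<and> (\<forall>i. i \<notin> {1..m} \<longrightarrow> x i = 0)}"

definition dual_cone :: "'a::real_inner set \<Rightarrow> 'a set"
  where "dual_cone C = {f. \<forall>x\<in>C. 0 \<le> f \<bullet> x}"

definition proper_cone :: "'a::euclidean_space set \<Rightarrow> bool"
  where "proper_cone C \<longleftrightarrow>
    convex_cone C \<and> closed C \<and> C \<inter> uminus ` C = {0} \<and> span C = UNIV"

(* C has a K-lift, where K lies in the vector space E (a subspace of the type 'b). Every linear
   map on E is the restriction of a linear map on 'b, so \<pi> may be total. *)
definition has_lift :: "'a::real_vector set \<Rightarrow> 'b::real_vector set \<Rightarrow> 'b set \<Rightarrow> bool"
  where "has_lift C E K \<longleftrightarrow>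
    (\<exists>\<pi> L. linear \<pi> \<and> subspace L \<and> L \<subseteq> E \<and> C = \<pi> ` (K \<inter> L))"

definition face_chain :: "'b::real_vector set \<Rightarrow> 'b set list \<Rightarrow> bool"
  where "face_chain K Fs \<longleftrightarrow>
    (\<forall>F\<in>set Fs. F face_of K \<and> F \<noteq> {}) \<and> sorted_wrt (\<subset>) Fs"

(* \<ell>(K). The supremum is taken in enat so that it is meaningful without a finiteness proof;
   when finite it is a maximum. *)
definition max_chain_length :: "'b::real_vector set \<Rightarrow> enat"
  where "max_chain_length K = (SUP Fs\<in>{Fs. face_chain K Fs}. enat (length Fs))"

definition ray :: "'a::real_vector \<Rightarrow> 'a set"
  where "ray v = (\<lambda>t. t *\<^sub>R v) ` {0..}"

definition normalized_extreme_rays :: "'a::euclidean_space set \<Rightarrow> 'a set"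
  where "normalized_extreme_rays C = {v. norm v = 1 \<and> ray v face_of C}"

definition neighborly :: "nat \<Rightarrow> 'a::euclidean_space set \<Rightarrow> 'a set \<Rightarrow> bool"
  where "neighborly k C V \<longleftrightarrow>
    (\<forall>W\<subseteq>V. finite W \<and> card W = k \<longrightarrow>
      (\<exists>f\<in>dual_cone C. (\<forall>v\<in>W. f \<bullet> v = 0) \<and> (\<forall>v\<in>V - W. f \<bullet> v > 0)))"

end

theory Submission
  imports Defs "HOL-Library.Ramsey"
begin

text \<open>
  Suppose \<open>C = \<pi> ` (K \<inter> L)\<close> with \<open>K\<close> the product of the \<open>K i\<close>, and lift each \<open>v \<in> V\<close> to some
  \<open>y v \<in> K \<inter> L\<close>. Let \<open>W \<subseteq> V\<close> have \<open>k\<close> elements and put \<open>w = (\<Sum>u\<in>W. y u)\<close>. The functional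
  \<open>\<lambda>x. f\<^sub>W \<bullet> \<pi> x\<close> is nonnegative on \<open>K \<inter> L\<close> and vanishes at \<open>w\<close>, hence it vanishes on
  \<open>F \<inter> L\<close>, where \<open>F\<close> is the smallest face of \<open>K\<close> containing \<open>w\<close>. It is positive at \<open>y v\<close> for
  \<open>v \<in> V - W\<close>, so \<open>y v \<notin> F\<close>. As \<open>F\<close> is the product of the smallest faces of the \<open>K i\<close>
  containing \<open>w i\<close>, some component \<open>i\<close> witnesses this (\<open>neighborly_lift_separates\<close>).

  Enumerate finitely many elements of \<open>V\<close> and colour a \<open>(k + 1)\<close>-subset by a component that
  witnesses that the lift of its largest element lies outside the face generated by the lifts of
  the other \<open>k\<close>. With enough elements, Ramsey's theorem gives \<open>2 * k + 1\<close> points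
  \<open>h 0, \<dots>, h (2 * k)\<close> all of whose \<open>(k + 1)\<close>-subsets have the same colour \<open>i\<close>. Then for every
  \<open>j \<le> k\<close> the point \<open>h (j + k)\<close> escapes the face of \<open>K i\<close> generated by the \<open>k\<close> points before it.
  These include \<open>h k, \<dots>, h (j + k - 1)\<close>, so the faces generated by the first
  \<open>0, 1, \<dots>, k + 1\<close> of the points \<open>h k, \<dots>, h (2 * k)\<close> increase strictly. This is a chain of
  \<open>k + 2\<close> nonempty faces of \<open>K i\<close>, one more than \<open>K i\<close> admits.

  The smallest face of \<open>K\<close> containing \<open>w\<close> consists of the \<open>x \<in> K\<close> with \<open>w - \<epsilon> *\<^sub>R x \<in> K\<close> for some
  \<open>\<epsilon> > 0\<close>. In this form the vanishing claim is immediate: if \<open>x\<close> and \<open>w\<close> lie in \<open>L\<close>, then so does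
  \<open>w - \<epsilon> *\<^sub>R x\<close>, and nonnegativity of \<open>f\<^sub>W \<circ> \<pi>\<close> at this point forces its value at \<open>x\<close> to be \<open>0\<close>.
\<close>

section \<open>The face of a cone generated by a point\<close>

text \<open>
  For \<open>w\<close> in a convex cone \<open>K\<close> this is the smallest face of \<open>K\<close> containing \<open>w\<close>: it consists of
  the points \<open>x\<close> of \<open>K\<close> such that the segment from \<open>x\<close> to \<open>w\<close> can be prolonged beyond \<open>w\<close>
  within \<open>K\<close>; the prolonged point is a positive multiple of \<open>w - \<epsilon> *\<^sub>R x\<close> with \<open>\<epsilon> < 1\<close>.
\<close>

definition generated_face :: "'b::real_vector set \<Rightarrow> 'b \<Rightarrow> 'b set"
  where "generated_face K w = {x \<in> K. \<exists>\<epsilon>>0. w - \<epsilon> *\<^sub>R x \<in> K}"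

lemma generated_faceI: "x \<in> K \<Longrightarrow> 0 < \<epsilon> \<Longrightarrow> w - \<epsilon> *\<^sub>R x \<in> K \<Longrightarrow> x \<in> generated_face K w"
  by (auto simp: generated_face_def)

lemma generated_face_smaller_step:
  assumes "convex_cone K" "x \<in> K" "w - \<epsilon> *\<^sub>R x \<in> K" "\<delta> \<le> \<epsilon>"
  shows "w - \<delta> *\<^sub>R x \<in> K"
proof -
  have "w - \<delta> *\<^sub>R x = (w - \<epsilon> *\<^sub>R x) + (\<epsilon> - \<delta>) *\<^sub>R x"
    by (simp add: scaleR_diff_left)
  also have "\<dots> \<in> K"
    using assms by (intro convex_cone_add convex_cone_scaleR) auto
  finally show ?thesis .
qed

lemma generated_face_face_of:
  fixes K :: "'b::real_vector set"
  assumes K: "convex_cone K"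
  shows "generated_face K w face_of K"
  unfolding face_of_def
proof (intro conjI ballI impI)
  show "generated_face K w \<subseteq> K"
    by (auto simp: generated_face_def)
  have "convex K"
    using K by (simp add: convex_cone_def)
  show "convex (generated_face K w)"
  proof (rule convexI)
    fix a b :: 'b and s t :: real
    assume a: "a \<in> generated_face K w" and b: "b \<in> generated_face K w"
      and st: "0 \<le> s" "0 \<le> t" "s + t = 1"
    obtain \<delta> \<epsilon> where "0 < \<delta>" "w - \<delta> *\<^sub>R a \<in> K" "0 < \<epsilon>" "w - \<epsilon> *\<^sub>R b \<in> K" "a \<in> K" "b \<in> K"
      using a b by (auto simp: generated_face_def)
    then have K': "w - min \<delta> \<epsilon> *\<^sub>R a \<in> K" "w - min \<delta> \<epsilon> *\<^sub>R b \<in> K" "0 < min \<delta> \<epsilon>"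
      by (auto intro: generated_face_smaller_step[OF K, where \<epsilon> = \<delta>]
          generated_face_smaller_step[OF K, where \<epsilon> = \<epsilon>])
    have "w - min \<delta> \<epsilon> *\<^sub>R (s *\<^sub>R a + t *\<^sub>R b)
        = (s + t) *\<^sub>R w - min \<delta> \<epsilon> *\<^sub>R (s *\<^sub>R a + t *\<^sub>R b)"
      using st by simp
    also have "\<dots> = s *\<^sub>R (w - min \<delta> \<epsilon> *\<^sub>R a) + t *\<^sub>R (w - min \<delta> \<epsilon> *\<^sub>R b)"
      by (simp add: algebra_simps)
    also have "\<dots> \<in> K"
      using \<open>convex K\<close> K' st by (auto intro: convexD)
    finally show "s *\<^sub>R a + t *\<^sub>R b \<in> generated_face K w"
      using \<open>a \<in> K\<close> \<open>b \<in> K\<close> \<open>convex K\<close> st K'(3)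
      by (intro generated_faceI[of _ _ "min \<delta> \<epsilon>"] convexD)
  qed
next
  have endpoint: "a \<in> generated_face K w"
    if "a \<in> K" "b \<in> K" and x: "x \<in> generated_face K w" "x \<in> open_segment a b" for a b x
  proof -
    obtain u where u: "0 < u" "u < 1" "x = (1 - u) *\<^sub>R a + u *\<^sub>R b"
      using x(2) by (auto simp: in_segment)
    obtain \<epsilon> where \<epsilon>: "0 < \<epsilon>" "w - \<epsilon> *\<^sub>R x \<in> K"
      using x(1) by (auto simp: generated_face_def)
    have "w - (\<epsilon> * (1 - u)) *\<^sub>R a = (w - \<epsilon> *\<^sub>R x) + (\<epsilon> * u) *\<^sub>R b"
      unfolding u(3) by (simp add: algebra_simps)
    also have "\<dots> \<in> K"
      using K \<epsilon> u \<open>b \<in> K\<close> by (intro convex_cone_add convex_cone_scaleR) auto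
    finally show ?thesis
      using \<open>a \<in> K\<close> \<epsilon> u by (intro generated_faceI[of _ _ "\<epsilon> * (1 - u)"]) auto
  qed
  fix a b x assume "a \<in> K" "b \<in> K" "x \<in> generated_face K w" "x \<in> open_segment a b"
  then show "a \<in> generated_face K w" "b \<in> generated_face K w"
    using endpoint[of a b x] endpoint[of b a x] by (auto simp: open_segment_commute)
qed

lemma convex_cone_sum: "convex_cone K \<Longrightarrow> (\<And>a. a \<in> A \<Longrightarrow> z a \<in> K) \<Longrightarrow> sum z A \<in> K"
  by (induction A rule: infinite_finite_induct) (auto intro: convex_cone_add convex_cone_contains_0)

lemma generated_face_sum_mono:
  assumes K: "convex_cone K" and "finite B" "A \<subseteq> B" and z: "\<And>b. b \<in> B \<Longrightarrow> z b \<in> K"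
  shows "generated_face K (sum z A) \<subseteq> generated_face K (sum z B)"
proof
  fix x assume "x \<in> generated_face K (sum z A)"
  then obtain \<epsilon> where \<epsilon>: "0 < \<epsilon>" "sum z A - \<epsilon> *\<^sub>R x \<in> K" "x \<in> K"
    by (auto simp: generated_face_def)
  have "sum z B - \<epsilon> *\<^sub>R x = sum z (B - A) + (sum z A - \<epsilon> *\<^sub>R x)"
    using sum.subset_diff[OF \<open>A \<subseteq> B\<close> \<open>finite B\<close>, of z] by simp
  also have "\<dots> \<in> K"
    using \<epsilon> z K by (intro convex_cone_add convex_cone_sum) auto
  finally show "x \<in> generated_face K (sum z B)"
    using \<epsilon> by (auto intro: generated_faceI)
qed

lemma summand_in_generated_face:
  assumes K: "convex_cone K" and "finite A" "a \<in> A" and z: "\<And>b. b \<in> A \<Longrightarrow> z b \<in> K"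
  shows "z a \<in> generated_face K (sum z A)"
proof (rule generated_faceI[of _ _ 1])
  have "sum z A - 1 *\<^sub>R z a = sum z (A - {a})"
    using assms by (simp add: sum.remove)
  then show "sum z A - 1 *\<^sub>R z a \<in> K"
    using K z by (auto intro: convex_cone_sum)
qed (use assms in auto)

text \<open>
  Each point that escapes the face generated by its predecessors makes the generated face grow.
  The chain starts with the face generated by the empty sum, the lineality space of \<open>K\<close>;
  this is why \<open>n\<close> points yield \<open>n + 1\<close> faces.
\<close>

lemma max_chain_length_ge_escaping_points:
  fixes K :: "'b::real_vector set"
  assumes K: "convex_cone K" and z: "\<And>j. j < n \<Longrightarrow> z j \<in> K"
    and escape: "\<And>j. j < n \<Longrightarrow> z j \<notin> generated_face K (\<Sum>p<j. z p)"
  shows "enat (Suc n) \<le> max_chain_length K"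
proof -
  define F where "F j = generated_face K (\<Sum>p<j. z p)" for j
  have strict: "F i \<subset> F j" if "i < j" "j \<le> n" for i j
  proof -
    have "F i \<subseteq> F j"
      unfolding F_def using that by (intro generated_face_sum_mono K z) auto
    moreover have "z i \<in> F j"
      unfolding F_def using that by (intro summand_in_generated_face K z) auto
    moreover have "z i \<notin> F i"
      using escape that by (simp add: F_def)
    ultimately show ?thesis by blast
  qed
  have "F j \<noteq> {}" if "j \<le> n" for j
  proof -
    have "0 \<in> F j"
      unfolding F_def using that K z
      by (intro generated_faceI[of _ _ 1]) (auto intro: convex_cone_sum convex_cone_contains_0)
    then show ?thesis by blast
  qed
  then have "face_chain K (map F [0..<Suc n])"
    using strict K
    by (auto simp: face_chain_def F_def[abs_def] generated_face_face_of sorted_wrt_iff_nth_less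
        simp del: upt_Suc)
  then have "enat (length (map F [0..<Suc n])) \<le> max_chain_length K"
    unfolding max_chain_length_def by (intro SUP_upper) simp
  then show ?thesis by simp
qed

lemma generated_face_product_set:
  assumes K: "\<And>i. i \<in> {1..m} \<Longrightarrow> convex_cone (K i)"
    and x: "x \<in> product_set m K" and w: "w \<in> product_set m K"
    and faces: "\<And>i. i \<in> {1..m} \<Longrightarrow> x i \<in> generated_face (K i) (w i)"
  shows "x \<in> generated_face (product_set m K) w"
proof -
  have "\<forall>i\<in>{1..m}. \<exists>\<epsilon>>0. w i - \<epsilon> *\<^sub>R x i \<in> K i"
    using faces by (auto simp: generated_face_def)
  then obtain \<epsilon> where \<epsilon>: "\<And>i. i \<in> {1..m} \<Longrightarrow> 0 < \<epsilon> i \<and> w i - \<epsilon> i *\<^sub>R x i \<in> K i"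
    by metis
  \<comment> \<open>One step size serves all components; the extra 1 keeps the minimum meaningful for \<open>m = 0\<close>.\<close>
  define \<delta> where "\<delta> = Min (insert 1 (\<epsilon> ` {1..m}))"
  have "0 < \<delta>"
    using \<epsilon> by (simp add: \<delta>_def)
  have "w i - \<delta> *\<^sub>R x i \<in> K i" if "i \<in> {1..m}" for i
  proof (rule generated_face_smaller_step[OF K[OF that]])
    show "x i \<in> K i" "w i - \<epsilon> i *\<^sub>R x i \<in> K i"
      using \<epsilon>[OF that] x that by (auto simp: product_set_def)
    show "\<delta> \<le> \<epsilon> i"
      unfolding \<delta>_def using that by (intro Min_le) auto
  qed
  then have "w - \<delta> *\<^sub>R x \<in> product_set m K"
    using x w by (auto simp: product_set_def)
  then show ?thesis
    using x \<open>0 < \<delta>\<close> by (auto intro: generated_faceI)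
qed

lemma linear_vanishes_on_generated_face:
  fixes g :: "'b::real_vector \<Rightarrow> real"
  assumes "linear g" "subspace L" and nonneg: "\<And>x. x \<in> K \<inter> L \<Longrightarrow> 0 \<le> g x"
    and "w \<in> L" "g w = 0" and x: "x \<in> generated_face K w" "x \<in> L"
  shows "g x = 0"
proof -
  obtain \<epsilon> where \<epsilon>: "0 < \<epsilon>" "w - \<epsilon> *\<^sub>R x \<in> K" "x \<in> K"
    using x by (auto simp: generated_face_def)
  have "w - \<epsilon> *\<^sub>R x \<in> L"
    using assms by (intro subspace_diff subspace_scale)
  then have "0 \<le> g (w - \<epsilon> *\<^sub>R x)"
    using \<epsilon> nonneg by blast
  also have "\<dots> = - (\<epsilon> * g x)"
    using assms by (simp add: linear_diff linear_scale)
  finally have "g x \<le> 0"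
    using \<open>0 < \<epsilon>\<close> by (simp add: mult_le_0_iff)
  moreover have "0 \<le> g x"
    using nonneg \<epsilon>(3) x(2) by blast
  ultimately show ?thesis by simp
qed

section \<open>Lifts of neighborly point sets\<close>

text \<open>
  Neighborliness passes from \<open>C\<close> to a factor of the lift: the functional exposing \<open>W\<close>, pulled
  back along \<open>\<pi>\<close>, rules out that \<open>y v\<close> lies in the face generated by the lifts of \<open>W\<close>, and a
  point outside a product of faces is outside one of the factors.
\<close>

lemma neighborly_lift_separates:
  fixes C :: "'a::euclidean_space set" and K :: "nat \<Rightarrow> 'b::real_vector set"
  assumes K: "\<And>i. i \<in> {1..m} \<Longrightarrow> convex_cone (K i)"
    and \<pi>: "linear \<pi>" and L: "subspace L" and C: "C = \<pi> ` (product_set m K \<inter> L)"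
    and nb: "neighborly k C V"
    and y: "\<And>v. v \<in> V \<Longrightarrow> y v \<in> product_set m K \<inter> L \<and> \<pi> (y v) = v"
    and W: "W \<subseteq> V" "finite W" "card W = k" and v: "v \<in> V - W"
  obtains i where "i \<in> {1..m}" "y v i \<notin> generated_face (K i) (\<Sum>u\<in>W. y u i)"
proof -
  obtain f where f: "f \<in> dual_cone C" "\<And>u. u \<in> W \<Longrightarrow> f \<bullet> u = 0" "f \<bullet> v > 0"
  proof -
    have "\<exists>f\<in>dual_cone C. (\<forall>u\<in>W. f \<bullet> u = 0) \<and> (\<forall>u\<in>V - W. f \<bullet> u > 0)"
      using nb W by (simp add: neighborly_def)
    then show thesis
      using v that by auto
  qed
  define w where "w = (\<Sum>u\<in>W. y u)"
  have w_apply: "w i = (\<Sum>u\<in>W. y u i)" for i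
    unfolding w_def using \<open>finite W\<close> by induction auto
  have yK: "y u i \<in> K i" if "u \<in> V" "i \<in> {1..m}" for u i
    using y[of u] that by (auto simp: product_set_def)
  have y0: "y u i = 0" if "u \<in> V" "i \<notin> {1..m}" for u i
    using y[OF that(1)] that(2) unfolding product_set_def by blast
  have "w \<in> product_set m K"
    unfolding product_set_def w_apply
  proof (intro CollectI conjI ballI allI impI)
    show "(\<Sum>u\<in>W. y u i) \<in> K i" if "i \<in> {1..m}" for i
      using that W yK by (intro convex_cone_sum K) auto
    show "(\<Sum>u\<in>W. y u i) = 0" if "i \<notin> {1..m}" for i
      using that W y0 by (intro sum.neutral) auto
  qed
  have lin: "linear (\<lambda>x. f \<bullet> \<pi> x)"
    using \<pi> by (simp add: linear_iff inner_add_right)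
  have "w \<in> L"
    unfolding w_def using W y by (intro subspace_sum L) auto
  have "\<pi> w = \<Sum>W"
    unfolding w_def linear_sum[OF \<pi>] using W y by (intro sum.cong) auto
  then have "f \<bullet> \<pi> w = 0"
    using f(2) by (simp add: inner_sum_right)
  have "y v \<notin> generated_face (product_set m K) w"
  proof
    assume "y v \<in> generated_face (product_set m K) w"
    moreover have "0 \<le> f \<bullet> \<pi> x" if "x \<in> product_set m K \<inter> L" for x
      using f(1) that by (auto simp: dual_cone_def C)
    ultimately have "f \<bullet> \<pi> (y v) = 0"
      using linear_vanishes_on_generated_face[OF lin L, of "product_set m K" w "y v"]
        \<open>w \<in> L\<close> \<open>f \<bullet> \<pi> w = 0\<close> y[of v] v by blast
    then show False
      using f(3) y[of v] v by auto
  qed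
  then have "\<exists>i\<in>{1..m}. y v i \<notin> generated_face (K i) (w i)"
    using generated_face_product_set[of m K "y v" w] K y[of v] v
      \<open>w \<in> product_set m K\<close> by blast
  then show ?thesis
    using that by (auto simp: w_apply)
qed

section \<open>Monochromatic windows\<close>

text \<open>
  Ramsey's theorem for \<open>(k + 1)\<close>-subsets of an initial segment of the naturals, each regarded as
  a \<open>k\<close>-set \<open>W\<close> followed by its largest element \<open>v\<close>. Of the \<open>(k + 1)\<close>-subsets of the
  homogeneous set only the \<open>k + 1\<close> windows of consecutive elements are recorded.
\<close>

lemma monochromatic_windows:
  fixes m k :: nat
  obtains N :: nat where
    "\<And>P :: nat \<Rightarrow> nat set \<Rightarrow> nat \<Rightarrow> bool.
      (\<And>W v. W \<subseteq> {..<v} \<Longrightarrow> card W = k \<Longrightarrow> v < N \<Longrightarrow> \<exists>i\<in>{1..m}. P i W v) \<Longrightarrow>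
      \<exists>i\<in>{1..m}. \<exists>h. strict_mono_on {..2 * k} h \<and> h ` {..2 * k} \<subseteq> {..<N} \<and>
        (\<forall>j\<le>k. P i (h ` {j..<j + k}) (h (j + k)))"
proof -
  obtain N :: nat where N: "partn_lst {..<N} (replicate m (2 * k + 1)) (k + 1)"
    using ramsey_full by blast
  have "\<exists>i\<in>{1..m}. \<exists>h. strict_mono_on {..2 * k} h \<and> h ` {..2 * k} \<subseteq> {..<N} \<and>
        (\<forall>j\<le>k. P i (h ` {j..<j + k}) (h (j + k)))"
    if P: "\<And>W v. W \<subseteq> {..<v} \<Longrightarrow> card W = k \<Longrightarrow> v < N \<Longrightarrow> \<exists>i\<in>{1..m}. P i W v"
    for P :: "nat \<Rightarrow> nat set \<Rightarrow> nat \<Rightarrow> bool"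
  proof -
    have "\<exists>c<m. P (Suc c) (S - {Max S}) (Max S)" if S: "S \<in> nsets {..<N} (k + 1)" for S
    proof -
      have S': "S \<subseteq> {..<N}" "finite S" "card S = k + 1" "S \<noteq> {}"
        using S by (auto simp: nsets_def)
      have "Max S \<in> S"
        using S' by simp
      then have "Max S < N" "card (S - {Max S}) = k"
        using S' by auto
      moreover have "S - {Max S} \<subseteq> {..<Max S}"
        using S' by (auto simp: le_neq_implies_less)
      ultimately obtain i where "i \<in> {1..m}" "P i (S - {Max S}) (Max S)"
        using P[of "S - {Max S}" "Max S"] by blast
      then show ?thesis
        by (intro exI[of _ "i - 1"]) auto
    qed
    then obtain c where c: "\<And>S. S \<in> nsets {..<N} (k + 1) \<Longrightarrow> c S < m"
        "\<And>S. S \<in> nsets {..<N} (k + 1) \<Longrightarrow> P (Suc (c S)) (S - {Max S}) (Max S)"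
      by metis
    obtain i H where i: "i < m" and H: "H \<in> nsets {..<N} (2 * k + 1)"
      and mono: "c ` nsets H (k + 1) \<subseteq> {i}"
    proof (rule partn_lstE[OF N, of c m])
      show "c \<in> nsets {..<N} (k + 1) \<rightarrow> {..<m}"
        using c(1) by auto
    qed (auto intro: that)
    have H': "H \<subseteq> {..<N}" "finite H" "card H = 2 * k + 1"
      using H by (auto simp: nsets_def)
    obtain h where "bij_betw h {..<card H} H" "strict_mono_on {..<card H} h"
      using ex_bij_betw_strict_mono_card[OF H'(2)] .
    moreover have "{..<card H} = {..2 * k}"
      using H' by auto
    ultimately have h: "h ` {..2 * k} = H" "strict_mono_on {..2 * k} h"
      by (auto simp: bij_betw_def)
    have "P (Suc i) (h ` {j..<j + k}) (h (j + k))" if "j \<le> k" for j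
    proof -
      have less: "h p < h q" if "p < q" "q \<le> j + k" for p q
        using that \<open>j \<le> k\<close> by (intro strict_mono_onD[OF h(2)]) auto
      have inj: "inj_on h {j..j + k}"
        by (intro inj_on_subset[OF strict_mono_on_imp_inj_on[OF h(2)]]) (use that in auto)
      define S where "S = h ` {j..j + k}"
      have S: "S \<in> nsets H (k + 1)"
        unfolding nsets_def S_def using h(1) that inj by (auto simp: card_image)
      have Max: "Max S = h (j + k)"
        unfolding S_def
      proof (rule Max_eqI)
        fix a assume "a \<in> h ` {j..j + k}"
        then obtain p where "a = h p" "p \<le> j + k"
          by auto
        then show "a \<le> h (j + k)"
          using less[of p "j + k"] by (cases "p = j + k") auto
      qed auto
      have "S - {h (j + k)} = h ` ({j..j + k} - {j + k})"
        unfolding S_def using inj by (subst inj_on_image_set_diff[OF inj]) auto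
      also have "{j..j + k} - {j + k} = {j..<j + k}"
        by auto
      finally have rest: "S - {Max S} = h ` {j..<j + k}"
        by (simp add: Max)
      have "P (Suc (c S)) (S - {Max S}) (Max S)"
        using c(2) S nsets_mono[OF H'(1)] by blast
      moreover have "c S = i"
        using mono S by auto
      ultimately show ?thesis
        by (metis rest Max)
    qed
    then show ?thesis
      using i h H'(1) by (intro bexI[of _ "Suc i"] exI[of _ h]) auto
  qed
  then show thesis
    using that by blast
qed

section \<open>Neighborliness obstructs lifts to products of cones with short chains\<close>

theorem theorem1p4:
  fixes C :: "'a::euclidean_space set"
    and k m :: nat
    and d :: "nat \<Rightarrow> nat"
    and K :: "nat \<Rightarrow> (nat \<Rightarrow> real) set"
  assumes "proper_cone C"
    and "k \<ge> 1" and "m \<ge> 1"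
    and "\<And>i. i \<in> {1..m} \<Longrightarrow> K i \<subseteq> coord_space (d i)"
    and "\<And>i. i \<in> {1..m} \<Longrightarrow> convex_cone (K i) \<and> closed (K i)"
    and "\<And>i. i \<in> {1..m} \<Longrightarrow> max_chain_length (K i) \<le> enat (k + 1)"
    and "\<And>N::nat. \<exists>V \<subseteq> normalized_extreme_rays C.
           neighborly k C V \<and> (infinite V \<or> card V \<ge> N)"
  shows "\<not> has_lift C (product_set m (\<lambda>i. coord_space (d i))) (product_set m K)"
proof
  assume "has_lift C (product_set m (\<lambda>i. coord_space (d i))) (product_set m K)"
  then obtain \<pi> :: "(nat \<Rightarrow> nat \<Rightarrow> real) \<Rightarrow> 'a" and L
    where \<pi>: "linear \<pi>" and L: "subspace L" and C: "C = \<pi> ` (product_set m K \<inter> L)"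
    unfolding has_lift_def by blast
  have cone: "convex_cone (K i)" if "i \<in> {1..m}" for i
    using assms(5) that by blast
  obtain N :: nat where windows: "\<And>P :: nat \<Rightarrow> nat set \<Rightarrow> nat \<Rightarrow> bool.
      (\<And>W v. W \<subseteq> {..<v} \<Longrightarrow> card W = k \<Longrightarrow> v < N \<Longrightarrow> \<exists>i\<in>{1..m}. P i W v) \<Longrightarrow>
      \<exists>i\<in>{1..m}. \<exists>h. strict_mono_on {..2 * k} h \<and> h ` {..2 * k} \<subseteq> {..<N} \<and>
        (\<forall>j\<le>k. P i (h ` {j..<j + k}) (h (j + k)))"
    using monochromatic_windows[of k m] by blast
  obtain V where V: "V \<subseteq> normalized_extreme_rays C" "neighborly k C V" "infinite V \<or> card V \<ge> N"
    using assms(7) by blast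
  have "V \<subseteq> C"
  proof
    fix v assume "v \<in> V"
    then have "ray v \<subseteq> C"
      using V(1) by (auto simp: normalized_extreme_rays_def dest: face_of_imp_subset)
    moreover have "v \<in> ray v"
      unfolding ray_def by (rule image_eqI[of _ _ 1]) auto
    ultimately show "v \<in> C" by blast
  qed
  then have "\<forall>v\<in>V. \<exists>x. x \<in> product_set m K \<inter> L \<and> \<pi> x = v"
    unfolding C by blast
  then obtain y where y: "\<And>v. v \<in> V \<Longrightarrow> y v \<in> product_set m K \<inter> L \<and> \<pi> (y v) = v"
    by metis
  obtain V' where "V' \<subseteq> V" "finite V'" "card V' = N"
    using V(3) infinite_arbitrarily_large obtain_subset_with_card_n by metis
  then obtain e where e: "e ` {..<N} \<subseteq> V" "inj_on e {..<N}"
    using ex_bij_betw_nat_finite[of V'] by (auto simp: bij_betw_def atLeast0LessThan)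
  have eV: "e p \<in> V" if "p < N" for p
    using e(1) that by blast
  have "\<exists>i\<in>{1..m}. y (e v) i \<notin> generated_face (K i) (\<Sum>p\<in>W. y (e p) i)"
    if W: "W \<subseteq> {..<v}" "card W = k" and v: "v < N" for W v
  proof -
    have "W \<subseteq> {..<N}" "finite W" "v \<notin> W"
      using W v finite_subset[OF W(1)] by auto
    moreover from this have injW: "inj_on e W"
      using e(2) inj_on_subset by blast
    moreover have "e v \<notin> e ` W"
      using calculation e(2) v inj_on_image_mem_iff[of e "{..<N}" v W] by auto
    moreover have "e ` W \<subseteq> V" "card (e ` W) = k" "e v \<in> V"
      using calculation eV v W(2) by (auto simp: card_image)
    ultimately obtain i where "i \<in> {1..m}"
        "y (e v) i \<notin> generated_face (K i) (\<Sum>u\<in>e ` W. y u i)"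
      using neighborly_lift_separates[OF cone \<pi> L C V(2) y, of "e ` W" "e v"] by blast
    then show ?thesis
      by (auto simp: sum.reindex[OF injW])
  qed
  then obtain i h where i: "i \<in> {1..m}" and h: "strict_mono_on {..2 * k} h" "h ` {..2 * k} \<subseteq> {..<N}"
    and escape: "\<And>j. j \<le> k \<Longrightarrow> y (e (h (j + k))) i
        \<notin> generated_face (K i) (\<Sum>p\<in>h ` {j..<j + k}. y (e p) i)"
    using windows[of "\<lambda>i W v. y (e v) i \<notin> generated_face (K i) (\<Sum>p\<in>W. y (e p) i)"] by blast
  define z where "z p = y (e (h p)) i" for p
  have zK: "z p \<in> K i" if "p \<le> 2 * k" for p
    using y[OF eV, of "h p"] h(2) i that by (auto simp: z_def product_set_def)
  have "enat (Suc (k + 1)) \<le> max_chain_length (K i)"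
  proof (rule max_chain_length_ge_escaping_points[OF cone[OF i], where z = "\<lambda>j. z (j + k)"])
    fix j assume j: "j < k + 1"
    show "z (j + k) \<in> K i"
      using j by (intro zK) simp
    have "inj_on h {j..<j + k}"
      by (intro inj_on_subset[OF strict_mono_on_imp_inj_on[OF h(1)]]) (use j in auto)
    then have "z (j + k) \<notin> generated_face (K i) (sum z {j..<j + k})"
      using escape[of j] j by (simp add: z_def sum.reindex)
    \<comment> \<open>Since \<open>j \<le> k\<close>, the window \<open>{j..<j + k}\<close> contains the earlier chain points \<open>{k..<j + k}\<close>.\<close>
    moreover have "generated_face (K i) (sum z {k..<j + k}) \<subseteq> generated_face (K i) (sum z {j..<j + k})"
      using j by (intro generated_face_sum_mono cone i zK) auto
    moreover have "(\<Sum>p<j. z (p + k)) = sum z {k..<j + k}"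
      using sum.shift_bounds_nat_ivl[of z 0 k j] by (simp add: atLeast0LessThan)
    ultimately show "z (j + k) \<notin> generated_face (K i) (\<Sum>p<j. z (p + k))"
      by auto
  qed
  also have "\<dots> \<le> enat (k + 1)"
    using assms(6)[OF i] .
  finally show False
    by simp
qed

end
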